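(* Let $(\rho,\overline{J})$ be a charge distribution and current satisfying the continuity equation $\frac{\partial\rho}{\partial t}+\nabla\cdot\overline{J}=0$ in the rest frame $S$, and suppose that $(\rho,\overline{J})$ is non-radiating. Then $(\rho,\overline{J})$ satisfy the wave equations $\square^{2}(\rho)=0$ and $\square^{2}(\overline{J})=\overline{0}$.
   Context: All quantities are smooth functions of space and time, with charges scalar valued and currents and fields vector valued. $\epsilon_{0},\mu_{0}>0$ are constants, $c=1/\sqrt{\mu_{0}\epsilon_{0}}$, and $\square^{2}=\nabla^{2}-\mu_{0}\epsilon_{0}\frac{\partial^{2}}{\partial t^{2}}$, acting componentwise on vector fields. Maxwell's equations for $(\rho,\overline{J},\overline{E},\overline{B})$ are: $\nabla\cdot\overline{E}=\rho/\epsilon_{0}$, $\nabla\cdot\overline{B}=0$, $\nabla\times\overline{E}=-\frac{\partial\overline{B}}{\partial t}$, $\nabla\times\overline{B}=\mu_{0}\overline{J}+\mu_{0}\epsilon_{0}\frac{\partial\overline{E}}{\partial t}$. The inertial frame $S'$ with velocity vector $\overline{v}$ relative to $S$, $v=|\overline{v}|<c$, has coordinates $(\overline{x}',t')$ given by the Lorentz transformation $\overline{x}'_{||}=\gamma(\overline{x}_{||}-\overline{v}t)$, $\overline{x}'_{\perp}=\overline{x}_{\perp}$, $t'=\gamma(t-\overline{v}\cdot\overline{x}/c^{2})$, with $\gamma=(1-v^{2}/c^{2})^{-1/2}$, where $||$ and $\perp$ denote the components parallel and perpendicular to $\overline{v}$ (the case $\overline{v}=\overline{0}$ is $S$ itself).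 The transformed charge and current are $\rho'=\gamma(\rho-vJ_{||}/c^{2})$ and $\overline{J}'=\gamma(\overline{J}_{||}-\rho\overline{v})+\overline{J}_{\perp}$, where $vJ_{||}=\overline{v}\cdot\overline{J}$, regarded as functions of $(\overline{x}',t')$. Maxwell's equations in $S'$ are the same equations with respect to the coordinates $(\overline{x}',t')$. Definition: $(\rho,\overline{J})$, satisfying the continuity equation in $S$, is non-radiating if in any inertial frame $S'$, with velocity vector $\overline{v}$, for the transformed current and charge $(\rho',\overline{J}')$, there exist electric and magnetic fields $(\overline{E}',\overline{B}')$ in $S'$ such that $(\rho',\overline{J}',\overline{E}',\overline{B}')$ satisfy Maxwell's equations in $S'$ and $\overline{B}'=\overline{0}$. *)

theory Defs
  imports "HOL-Analysis.Analysis"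
begin

type_synonym spacetime = "(real^3) \<times> real"

definition dir_deriv ::
  "spacetime \<Rightarrow> (spacetime \<Rightarrow> 'b::real_normed_vector) \<Rightarrow> spacetime \<Rightarrow> 'b" where
  "dir_deriv d f p = vector_derivative (\<lambda>s. f (p + s *\<^sub>R d)) (at 0)"

abbreviation partial_x :: "3 \<Rightarrow> (spacetime \<Rightarrow> 'b::real_normed_vector) \<Rightarrow> spacetime \<Rightarrow> 'b" where
  "partial_x i \<equiv> dir_deriv (axis i 1, 0)"

abbreviation partial_t :: "(spacetime \<Rightarrow> 'b::real_normed_vector) \<Rightarrow> spacetime \<Rightarrow> 'b" where
  "partial_t \<equiv> dir_deriv (0, 1)"

primrec Ck :: "nat \<Rightarrow> (spacetime \<Rightarrow> 'b::real_normed_vector) \<Rightarrow> bool" where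
  "Ck 0 f \<longleftrightarrow> continuous_on UNIV f"
| "Ck (Suc k) f \<longleftrightarrow> (\<forall>p. f differentiable (at p)) \<and> (\<forall>d. Ck k (dir_deriv d f))"

definition smooth :: "(spacetime \<Rightarrow> 'b::real_normed_vector) \<Rightarrow> bool" where
  "smooth f \<longleftrightarrow> (\<forall>k. Ck k f)"

definition divergence :: "(spacetime \<Rightarrow> real^3) \<Rightarrow> spacetime \<Rightarrow> real" where
  "divergence F p = (\<Sum>i\<in>UNIV. partial_x i (\<lambda>q. F q $ i) p)"

definition curl :: "(spacetime \<Rightarrow> real^3) \<Rightarrow> spacetime \<Rightarrow> real^3" where
  "curl F p = vector
     [partial_x 2 (\<lambda>q. F q $ 3) p - partial_x 3 (\<lambda>q. F q $ 2) p,
      partial_x 3 (\<lambda>q. F q $ 1) p - partial_x 1 (\<lambda>q. F q $ 3) p,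
      partial_x 1 (\<lambda>q. F q $ 2) p - partial_x 2 (\<lambda>q. F q $ 1) p]"

definition laplacian :: "(spacetime \<Rightarrow> real) \<Rightarrow> spacetime \<Rightarrow> real" where
  "laplacian f p = (\<Sum>i\<in>UNIV. partial_x i (partial_x i f) p)"

definition dalembertian :: "real \<Rightarrow> real \<Rightarrow> (spacetime \<Rightarrow> real) \<Rightarrow> spacetime \<Rightarrow> real" where
  "dalembertian \<epsilon>\<^sub>0 \<mu>\<^sub>0 f p = laplacian f p - \<mu>\<^sub>0 * \<epsilon>\<^sub>0 * partial_t (partial_t f) p"

definition dalembertian_vec :: "real \<Rightarrow> real \<Rightarrow> (spacetime \<Rightarrow> real^3) \<Rightarrow> spacetime \<Rightarrow> real^3" where
  "dalembertian_vec \<epsilon>\<^sub>0 \<mu>\<^sub>0 F p = (\<chi> i. dalembertian \<epsilon>\<^sub>0 \<mu>\<^sub>0 (\<lambda>q. F q $ i) p)"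

definition continuity_equation ::
  "(spacetime \<Rightarrow> real) \<Rightarrow> (spacetime \<Rightarrow> real^3) \<Rightarrow> bool" where
  "continuity_equation \<rho> J \<longleftrightarrow> (\<forall>p. partial_t \<rho> p + divergence J p = 0)"

definition maxwell ::
  "real \<Rightarrow> real \<Rightarrow> (spacetime \<Rightarrow> real) \<Rightarrow> (spacetime \<Rightarrow> real^3) \<Rightarrow>
   (spacetime \<Rightarrow> real^3) \<Rightarrow> (spacetime \<Rightarrow> real^3) \<Rightarrow> bool" where
  "maxwell \<epsilon>\<^sub>0 \<mu>\<^sub>0 \<rho> J E B \<longleftrightarrow>
     (\<forall>p. divergence E p = \<rho> p / \<epsilon>\<^sub>0) \<and>
     (\<forall>p. divergence B p = 0) \<and>
     (\<forall>p. curl E p = - partial_t B p) \<and>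
     (\<forall>p. curl B p = \<mu>\<^sub>0 *\<^sub>R J p + (\<mu>\<^sub>0 * \<epsilon>\<^sub>0) *\<^sub>R partial_t E p)"

definition light_speed :: "real \<Rightarrow> real \<Rightarrow> real" where
  "light_speed \<epsilon>\<^sub>0 \<mu>\<^sub>0 = 1 / sqrt (\<mu>\<^sub>0 * \<epsilon>\<^sub>0)"

definition gamma :: "real \<Rightarrow> real^3 \<Rightarrow> real" where
  "gamma c v = 1 / sqrt (1 - (norm v)\<^sup>2 / c\<^sup>2)"

text \<open>For \<open>v = 0\<close> the division by zero gives \<open>par 0 w = 0\<close> and \<open>perp 0 w = w\<close>,
  so that the formulas below reduce to the identity, as they should.\<close>

definition par :: "real^3 \<Rightarrow> real^3 \<Rightarrow> real^3" where
  "par v w = ((v \<bullet> w) / (v \<bullet> v)) *\<^sub>R v"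

definition perp :: "real^3 \<Rightarrow> real^3 \<Rightarrow> real^3" where
  "perp v w = w - par v w"

definition lorentz :: "real \<Rightarrow> real^3 \<Rightarrow> spacetime \<Rightarrow> spacetime" where
  "lorentz c v = (\<lambda>(x, t).
     (gamma c v *\<^sub>R (par v x - t *\<^sub>R v) + perp v x, gamma c v * (t - (v \<bullet> x) / c\<^sup>2)))"

text \<open>The sources in the moving frame are functions of the primed coordinates, hence the
  composition with the inverse of the coordinate change.\<close>

definition charge_in_frame ::
  "real \<Rightarrow> real^3 \<Rightarrow> (spacetime \<Rightarrow> real) \<Rightarrow> (spacetime \<Rightarrow> real^3) \<Rightarrow> spacetime \<Rightarrow> real" where
  "charge_in_frame c v \<rho> J =
     (\<lambda>p. gamma c v * (\<rho> p - (v \<bullet> J p) / c\<^sup>2)) \<circ> inv (lorentz c v)"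

definition current_in_frame ::
  "real \<Rightarrow> real^3 \<Rightarrow> (spacetime \<Rightarrow> real) \<Rightarrow> (spacetime \<Rightarrow> real^3) \<Rightarrow> spacetime \<Rightarrow> real^3" where
  "current_in_frame c v \<rho> J =
     (\<lambda>p. gamma c v *\<^sub>R (par v (J p) - \<rho> p *\<^sub>R v) + perp v (J p)) \<circ> inv (lorentz c v)"

definition non_radiating ::
  "real \<Rightarrow> real \<Rightarrow> (spacetime \<Rightarrow> real) \<Rightarrow> (spacetime \<Rightarrow> real^3) \<Rightarrow> bool" where
  "non_radiating \<epsilon>\<^sub>0 \<mu>\<^sub>0 \<rho> J \<longleftrightarrow>
     continuity_equation \<rho> J \<and>
     (\<forall>v. norm v < light_speed \<epsilon>\<^sub>0 \<mu>\<^sub>0 \<longrightarrow>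
       (\<exists>E' B'. smooth E' \<and> smooth B' \<and>
          maxwell \<epsilon>\<^sub>0 \<mu>\<^sub>0
            (charge_in_frame (light_speed \<epsilon>\<^sub>0 \<mu>\<^sub>0) v \<rho> J)
            (current_in_frame (light_speed \<epsilon>\<^sub>0 \<mu>\<^sub>0) v \<rho> J) E' B' \<and>
          (\<forall>p. B' p = 0)))"

lemma lorentz_uminus:
  assumes "norm v < c"
  shows "lorentz c (- v) (lorentz c v p) = p"
proof (cases "v = 0")
  case True
  then show ?thesis
    by (cases p) (simp add: lorentz_def par_def perp_def gamma_def)
next
  case False
  obtain x t where p: "p = (x, t)" by (cases p)
  define g where "g = gamma c v"
  define a where "a = (v \<bullet> x) / (v \<bullet> v)"
  have vv: "v \<bullet> v > 0" using False by simp
  have c: "c > 0" using assms norm_ge_zero[of v] by linarith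
  have lt: "v \<bullet> v < c\<^sup>2"
    using assms c by (simp add: dot_square_norm power_strict_mono)
  have pos: "1 - (v \<bullet> v) / c\<^sup>2 > 0" using lt c by simp
  have "g = 1 / sqrt (1 - (v \<bullet> v) / c\<^sup>2)"
    by (simp add: g_def gamma_def dot_square_norm)
  then have "g\<^sup>2 = 1 / (1 - (v \<bullet> v) / c\<^sup>2)"
    using pos by (simp only: power_divide real_sqrt_pow2 less_imp_le power_one)
  then have g2: "g\<^sup>2 * (1 - (v \<bullet> v) / c\<^sup>2) = 1"
    using pos by (metis less_numeral_extra(3) nonzero_eq_divide_eq)
  have gm: "gamma c (- v) = g" by (simp add: g_def gamma_def)
  have vx: "v \<bullet> x = a * (v \<bullet> v)" using vv by (simp add: a_def)
  define y where "y = g *\<^sub>R (par v x - t *\<^sub>R v) + perp v x"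
  define s where "s = g * (t - (v \<bullet> x) / c\<^sup>2)"
  have y: "y = (g * (a - t)) *\<^sub>R v + (x - a *\<^sub>R v)"
    by (simp add: y_def perp_def par_def a_def algebra_simps)
  have vy: "v \<bullet> y = g * (a - t) * (v \<bullet> v)"
    by (simp add: y vx inner_add_right inner_diff_right)
  have L: "lorentz c v p = (y, s)" by (simp add: p lorentz_def y_def s_def g_def)
  have par: "par (- v) y = (g * (a - t)) *\<^sub>R v"
    using vv by (simp add: par_def vy)
  have s1: "s = g * (t - a * ((v \<bullet> v) / c\<^sup>2))" by (simp add: s_def vx)
  have "g * (g * (a - t) + s) = a * (g\<^sup>2 * (1 - (v \<bullet> v) / c\<^sup>2))"
    by (simp add: s1 power2_eq_square algebra_simps)
  then have e1: "g * (g * (a - t) + s) = a" by (simp add: g2)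
  have "g * (s + (v \<bullet> y) / c\<^sup>2) = t * (g\<^sup>2 * (1 - (v \<bullet> v) / c\<^sup>2))"
    by (simp add: s1 vy power2_eq_square algebra_simps add_divide_distrib diff_divide_distrib)
  then have e2: "g * (s + (v \<bullet> y) / c\<^sup>2) = t" by (simp add: g2)
  have "g *\<^sub>R (par (- v) y - s *\<^sub>R (- v)) + perp (- v) y
      = (g * (g * (a - t) + s)) *\<^sub>R v + (x - a *\<^sub>R v)"
    unfolding perp_def par by (simp add: y algebra_simps)
  then have "g *\<^sub>R (par (- v) y - s *\<^sub>R (- v)) + perp (- v) y = x"
    by (simp add: e1)
  then show ?thesis
    unfolding L using e2 by (simp add: p lorentz_def gm)
qed

lemma bij_lorentz:
  assumes "norm v < c"
  shows "bij (lorentz c v)"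
proof (rule o_bij)
  show "lorentz c (- v) \<circ> lorentz c v = id"
    using lorentz_uminus[OF assms] by auto
  show "lorentz c v \<circ> lorentz c (- v) = id"
    using lorentz_uminus[of "- v" c] assms by auto
qed

end

theory Submission
  imports Defs
begin

text \<open>
  A frame with vanishing magnetic field has \<open>J' = - \<epsilon>\<^sub>0 \<partial>\<^sub>t E'\<close> by Ampere's law and
  \<open>curl E' = 0\<close> by Faraday's law. As partial derivatives commute, \<open>curl J' = 0\<close>
  (\<open>maxwell_no_magnetic_field_imp_curl_free\<close>). So the current of a non-radiating
  distribution is curl free in every inertial frame.

  The spatial curl consists of the space-space components of the antisymmetric tensor
  \<open>\<partial>\<^sub>\<mu> j\<^sub>\<nu> - \<partial>\<^sub>\<nu> j\<^sub>\<mu>\<close>, where \<open>j\<close> is the four-current, and a boost mixes them with the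
  time-space components. If the space-space components vanish in all frames, then so do the
  time-space ones, that is, \<open>\<partial>\<^sub>t J = - c\<^sup>2 grad \<rho>\<close>
  (\<open>non_radiating_imp_partial_t_current\<close>). Boosts along the coordinate axes suffice.

  The two first-order relations \<open>curl J = 0\<close> and \<open>\<partial>\<^sub>t J = - c\<^sup>2 grad \<rho>\<close> turn both wave
  operators into derivatives of the left-hand side of the continuity equation:
  \<open>\<box>\<^sup>2 \<rho> = - (1 / c\<^sup>2) \<partial>\<^sub>t (\<partial>\<^sub>t \<rho> + div J)\<close> and
  \<open>\<box>\<^sup>2 J = grad (\<partial>\<^sub>t \<rho> + div J)\<close>.
\<close>

section \<open>Directional derivatives\<close>

lemma has_vector_derivative_along_line:
  assumes "f differentiable (at (p + s *\<^sub>R d))"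
  shows "((\<lambda>r. f (p + r *\<^sub>R d)) has_vector_derivative
           frechet_derivative f (at (p + s *\<^sub>R d)) d) (at s)"
proof -
  have "(f has_derivative frechet_derivative f (at (p + s *\<^sub>R d))) (at (p + s *\<^sub>R d))"
    using assms by (simp add: frechet_derivative_works)
  moreover have "((\<lambda>r. p + r *\<^sub>R d) has_vector_derivative d) (at s)"
    by (auto intro!: derivative_eq_intros)
  ultimately show ?thesis
    using vector_derivative_diff_chain_within[of "\<lambda>r. p + r *\<^sub>R d" d s UNIV f]
    by (auto simp: o_def intro: has_derivative_at_withinI)
qed

lemma dir_deriv_eq_frechet_derivative:
  assumes "f differentiable (at p)"
  shows "dir_deriv d f p = frechet_derivative f (at p) d"
  using has_vector_derivative_along_line[of f p 0 d] assms
  by (simp add: dir_deriv_def vector_derivative_at)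

lemma has_vector_derivative_dir_deriv:
  assumes "f differentiable (at (p + s *\<^sub>R d))"
  shows "((\<lambda>r. f (p + r *\<^sub>R d)) has_vector_derivative dir_deriv d f (p + s *\<^sub>R d)) (at s)"
  using has_vector_derivative_along_line[OF assms]
  by (simp add: dir_deriv_eq_frechet_derivative[OF assms])

lemma dir_deriv_add_direction:
  assumes "f differentiable (at p)"
  shows "dir_deriv (a + b) f p = dir_deriv a f p + dir_deriv b f p"
  using linear_frechet_derivative[OF assms]
  by (simp add: dir_deriv_eq_frechet_derivative[OF assms] linear_add)

lemma dir_deriv_scaleR_direction:
  assumes "f differentiable (at p)"
  shows "dir_deriv (r *\<^sub>R a) f p = r *\<^sub>R dir_deriv a f p"
  using linear_frechet_derivative[OF assms]
  by (simp add: dir_deriv_eq_frechet_derivative[OF assms] linear_cmul)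

lemma dir_deriv_bounded_linear:
  assumes "bounded_linear L" and "f differentiable (at p)"
  shows "dir_deriv d (\<lambda>q. L (f q)) p = L (dir_deriv d f p)"
  using bounded_linear.has_vector_derivative[OF assms(1)
      has_vector_derivative_dir_deriv[of f p 0 d]] assms(2)
  by (simp add: dir_deriv_def vector_derivative_at)

lemmas dir_deriv_component = dir_deriv_bounded_linear[OF bounded_linear_vec_nth]
lemmas dir_deriv_cmult = dir_deriv_bounded_linear[OF bounded_linear_mult_right]

lemma dir_deriv_add:
  assumes "f differentiable (at p)" and "g differentiable (at p)"
  shows "dir_deriv d (\<lambda>q. f q + g q) p = dir_deriv d f p + dir_deriv d g p"
  using has_vector_derivative_add[OF has_vector_derivative_dir_deriv[of f p 0 d]
      has_vector_derivative_dir_deriv[of g p 0 d]] assms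
  by (simp add: dir_deriv_def vector_derivative_at)

lemma dir_deriv_sum:
  assumes "\<And>i. i \<in> I \<Longrightarrow> f i differentiable (at p)"
  shows "dir_deriv d (\<lambda>q. \<Sum>i\<in>I. f i q) p = (\<Sum>i\<in>I. dir_deriv d (f i) p)"
proof -
  have "((\<lambda>s. \<Sum>i\<in>I. f i (p + s *\<^sub>R d)) has_vector_derivative
          (\<Sum>i\<in>I. dir_deriv d (f i) p)) (at 0)"
    using has_vector_derivative_dir_deriv[of "f i" p 0 d for i] assms
    by (auto intro!: has_vector_derivative_sum)
  then show ?thesis
    by (simp add: dir_deriv_def vector_derivative_at)
qed

lemma dir_deriv_const: "dir_deriv d (\<lambda>_. c) p = 0"
  by (simp add: dir_deriv_def)

section \<open>Smooth functions and the symmetry of second derivatives\<close>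

lemma smooth_dir_deriv: "smooth f \<Longrightarrow> smooth (dir_deriv d f)"
  using Ck.simps(2) unfolding smooth_def by blast

lemma smooth_imp_differentiable: "smooth f \<Longrightarrow> f differentiable (at p)"
  using Ck.simps(2) unfolding smooth_def by blast

lemma smooth_imp_isCont: "smooth f \<Longrightarrow> isCont f p"
  by (simp add: differentiable_imp_continuous_within smooth_imp_differentiable)

lemma Ck_component:
  fixes F :: "spacetime \<Rightarrow> real^'n"
  shows "Ck k F \<Longrightarrow> Ck k (\<lambda>q. F q $ i)"
proof (induction k arbitrary: F)
  case 0
  then show ?case by (auto intro: continuous_intros)
next
  case (Suc k)
  then have diff: "F differentiable (at p)" for p
    using Ck.simps(2) by blast
  have "(\<lambda>q. F q $ i) differentiable (at p)" for p
    using diff[of p] bounded_linear.has_derivative[OF bounded_linear_vec_nth]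
    unfolding differentiable_def by blast
  moreover have "dir_deriv d (\<lambda>q. F q $ i) = (\<lambda>q. dir_deriv d F q $ i)" for d
    using dir_deriv_component[OF diff] by blast
  ultimately show ?case using Suc by simp
qed

lemma smooth_component:
  fixes F :: "spacetime \<Rightarrow> real^'n"
  shows "smooth F \<Longrightarrow> smooth (\<lambda>q. F q $ i)"
  by (simp add: smooth_def Ck_component)

lemma mean_value_along_line:
  fixes f :: "spacetime \<Rightarrow> real"
  assumes "\<And>q. f differentiable (at q)" and "h > 0"
  obtains s where "0 < s" "s < h"
    and "f (p + h *\<^sub>R d) - f p = h * dir_deriv d f (p + s *\<^sub>R d)"
proof -
  have "((\<lambda>r. f (p + r *\<^sub>R d)) has_real_derivative dir_deriv d f (p + s *\<^sub>R d)) (at s)" for s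
    using has_vector_derivative_dir_deriv[OF assms(1)]
    by (simp add: has_real_derivative_iff_has_vector_derivative)
  from MVT2[OF assms(2) this] show ?thesis
    using that by auto
qed

text \<open>The mean value theorem in direction \<open>a\<close>, applied to the difference of \<open>f\<close> in direction
  \<open>b\<close>, and then in direction \<open>b\<close> writes the second-order difference quotient as a value of the
  mixed derivative near \<open>p\<close>. The quotient is symmetric in \<open>a\<close> and \<open>b\<close>, which makes this the
  core of the symmetry of second derivatives.\<close>

lemma second_difference_quotient_tendsto:
  fixes f :: "spacetime \<Rightarrow> real"
  assumes "smooth f"
  shows "((\<lambda>h. (f (p + h *\<^sub>R a + h *\<^sub>R b) - f (p + h *\<^sub>R a) - f (p + h *\<^sub>R b) + f p) / h\<^sup>2)
           \<longlongrightarrow> dir_deriv b (dir_deriv a f) p) (at_right 0)"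
    (is "(?Q \<longlongrightarrow> ?M p) _")
proof (rule tendstoI)
  fix e :: real
  assume "e > 0"
  have "isCont ?M p"
    by (intro smooth_imp_isCont smooth_dir_deriv assms)
  then obtain r where "r > 0" and r: "\<And>q. dist q p < r \<Longrightarrow> dist (?M q) (?M p) < e"
    using \<open>e > 0\<close> unfolding continuous_at_eps_delta by (metis dist_commute)
  define m where "m = r / (norm a + norm b + 1)"
  have pos: "norm a + norm b + 1 > 0"
    by (simp add: add_nonneg_pos)
  have "m > 0"
    using \<open>r > 0\<close> pos by (simp add: m_def)
  have "dist (?Q h) (?M p) < e" if h: "0 < h" "h < m" for h
  proof -
    let ?g = "\<lambda>q. f (q + h *\<^sub>R b) - f q"
    have f: "f differentiable (at q)" for q
      using assms by (rule smooth_imp_differentiable)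
    have shift: "(\<lambda>q. f (q + h *\<^sub>R b)) differentiable (at q)" for q
      using differentiable_chain_at[of "\<lambda>q. q + h *\<^sub>R b" q f] f by (auto simp: o_def)
    have g: "?g differentiable (at q)" for q
      using shift f by (rule differentiable_diff)
    have Dg: "dir_deriv a ?g q = dir_deriv a f (q + h *\<^sub>R b) - dir_deriv a f q" for q
    proof -
      have "((\<lambda>s. f (q + h *\<^sub>R b + s *\<^sub>R a) - f (q + s *\<^sub>R a)) has_vector_derivative
              dir_deriv a f (q + h *\<^sub>R b) - dir_deriv a f q) (at 0)"
        using has_vector_derivative_diff[OF
            has_vector_derivative_dir_deriv[of f "q + h *\<^sub>R b" 0 a]
            has_vector_derivative_dir_deriv[of f q 0 a]] f by simp
      then show ?thesis
        by (simp add: dir_deriv_def vector_derivative_at add_ac)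
    qed
    obtain s where s: "0 < s" "s < h"
      and s_eq: "?g (p + h *\<^sub>R a) - ?g p = h * dir_deriv a ?g (p + s *\<^sub>R a)"
      using mean_value_along_line[OF g \<open>0 < h\<close>] by blast
    have "dir_deriv a f differentiable (at q)" for q
      by (intro smooth_imp_differentiable smooth_dir_deriv assms)
    then obtain t where t: "0 < t" "t < h"
      and t_eq: "dir_deriv a f (p + s *\<^sub>R a + h *\<^sub>R b) - dir_deriv a f (p + s *\<^sub>R a)
          = h * ?M (p + s *\<^sub>R a + t *\<^sub>R b)"
      using mean_value_along_line[OF _ \<open>0 < h\<close>] by blast
    have "?Q h = ?M (p + s *\<^sub>R a + t *\<^sub>R b)"
      using s_eq t_eq \<open>0 < h\<close> by (simp add: Dg power2_eq_square field_simps)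
    moreover have "dist (p + s *\<^sub>R a + t *\<^sub>R b) p < r"
    proof -
      have "dist (p + s *\<^sub>R a + t *\<^sub>R b) p = norm (s *\<^sub>R a + t *\<^sub>R b)"
        by (simp add: dist_norm)
      also have "\<dots> \<le> s * norm a + t * norm b"
        using norm_triangle_ineq[of "s *\<^sub>R a" "t *\<^sub>R b"] s t by simp
      also have "\<dots> \<le> h * norm a + h * norm b"
        using s t by (intro add_mono mult_right_mono) auto
      also have "\<dots> < h * (norm a + norm b + 1)"
        using h by (simp add: algebra_simps)
      also have "\<dots> < r"
        using h(2) pos by (simp add: m_def field_simps)
      finally show ?thesis .
    qed
    ultimately show ?thesis
      using r by simp
  qed
  then show "\<forall>\<^sub>F h in at_right 0. dist (?Q h) (?M p) < e"
    using \<open>m > 0\<close> by (auto simp: eventually_at_right_field)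
qed

lemma dir_deriv_commute:
  fixes f :: "spacetime \<Rightarrow> real"
  assumes "smooth f"
  shows "dir_deriv a (dir_deriv b f) p = dir_deriv b (dir_deriv a f) p"
proof (rule tendsto_unique)
  show "at_right (0::real) \<noteq> bot" by simp
  show "((\<lambda>h. (f (p + h *\<^sub>R a + h *\<^sub>R b) - f (p + h *\<^sub>R a) - f (p + h *\<^sub>R b) + f p) / h\<^sup>2)
           \<longlongrightarrow> dir_deriv b (dir_deriv a f) p) (at_right 0)"
    using assms by (rule second_difference_quotient_tendsto)
  show "((\<lambda>h. (f (p + h *\<^sub>R a + h *\<^sub>R b) - f (p + h *\<^sub>R a) - f (p + h *\<^sub>R b) + f p) / h\<^sup>2)
           \<longlongrightarrow> dir_deriv a (dir_deriv b f) p) (at_right 0)"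
    using second_difference_quotient_tendsto[OF assms, of p b a]
    by (simp add: algebra_simps)
qed

section \<open>Frames without magnetic field\<close>

text \<open>Symmetry of the spatial Jacobian treats all pairs of axes alike, which spares later
  arguments a case distinction on the components of the curl.\<close>

lemma curl_eq_0_iff:
  "curl F p = 0 \<longleftrightarrow>
     (\<forall>i j. partial_x i (\<lambda>q. F q $ j) p = partial_x j (\<lambda>q. F q $ i) p)"
  by (auto simp: curl_def vec_eq_iff forall_3)

text \<open>The current is a multiple of \<open>\<partial>\<^sub>t E\<close>, and \<open>\<partial>\<^sub>t\<close> commutes with the curl, which
  annihilates \<open>E\<close>.\<close>

lemma maxwell_no_magnetic_field_imp_curl_free:
  assumes "\<mu>\<^sub>0 \<noteq> 0" and "smooth E" and "maxwell \<epsilon>\<^sub>0 \<mu>\<^sub>0 \<rho> J E B" and "\<And>p. B p = 0"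
  shows "curl J p = 0"
proof -
  have B: "B = (\<lambda>_. 0)"
    using assms(4) by blast
  have "curl E q = 0" for q
    using assms(3) by (simp add: maxwell_def B dir_deriv_const del: split_paired_All)
  then have E: "partial_x i (\<lambda>q. E q $ j) = partial_x j (\<lambda>q. E q $ i)" for i j
    unfolding curl_eq_0_iff by blast
  have "curl B q = 0" for q
    by (simp add: curl_eq_0_iff B dir_deriv_const)
  then have "\<mu>\<^sub>0 *\<^sub>R J q + (\<mu>\<^sub>0 * \<epsilon>\<^sub>0) *\<^sub>R partial_t E q = 0" for q
    using assms(3) by (simp add: maxwell_def del: split_paired_All)
  then have "\<mu>\<^sub>0 *\<^sub>R (J q + \<epsilon>\<^sub>0 *\<^sub>R partial_t E q) = 0" for q
    by (simp add: scaleR_add_right)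
  then have J: "J q = - \<epsilon>\<^sub>0 *\<^sub>R partial_t E q" for q
    using assms(1) by (simp add: add_eq_0_iff2)
  have comp: "smooth (\<lambda>q. E q $ i)" for i
    using assms(2) by (rule smooth_component)
  have Ji: "(\<lambda>q. J q $ i) = (\<lambda>q. - \<epsilon>\<^sub>0 * partial_t (\<lambda>q. E q $ i) q)" for i
    by (simp add: J dir_deriv_component smooth_imp_differentiable[OF assms(2)])
  have "partial_x i (\<lambda>q. J q $ j) p = - \<epsilon>\<^sub>0 * partial_t (partial_x i (\<lambda>q. E q $ j)) p" for i j
    unfolding Ji
    by (simp only: dir_deriv_cmult smooth_imp_differentiable smooth_dir_deriv comp
        dir_deriv_commute[OF comp, of "(axis i 1, 0)"])
  then show ?thesis
    unfolding curl_eq_0_iff by (metis E)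
qed

section \<open>Boosts along a coordinate axis\<close>

lemma inv_lorentz:
  assumes "norm v < c"
  shows "inv (lorentz c v) = lorentz c (- v)"
  using lorentz_uminus[OF assms] lorentz_uminus[of "- v" c] assms
  by (intro inv_unique_comp) (auto simp: fun_eq_iff)

lemma linear_lorentz: "linear (lorentz c v)"
  by (rule linearI)
    (auto simp: lorentz_def par_def perp_def inner_add_right algebra_simps add_divide_distrib)

lemma par_axis:
  assumes "u \<noteq> 0"
  shows "par (u *\<^sub>R axis k 1) w = (w $ k) *\<^sub>R axis k 1"
  using assms by (simp add: par_def inner_axis' inner_axis_axis power2_eq_square)

lemma lorentz_axis_parallel:
  assumes "u \<noteq> 0"
  shows "lorentz c (u *\<^sub>R axis k 1) (axis k 1, 0)
    = gamma c (u *\<^sub>R axis k 1) *\<^sub>R ((axis k 1, 0) + (- u / c\<^sup>2) *\<^sub>R (0, 1))"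
  using assms by (simp add: lorentz_def par_axis perp_def inner_axis_axis)

lemma lorentz_axis_perpendicular:
  assumes "u \<noteq> 0" and "i \<noteq> k"
  shows "lorentz c (u *\<^sub>R axis k 1) (axis i 1, 0) = (axis i 1, 0)"
  using assms by (simp add: lorentz_def par_axis perp_def inner_axis_axis)
    (simp add: axis_def)

lemma dir_deriv_comp_linear:
  assumes "linear L"
  shows "dir_deriv d (\<lambda>q. f (L q)) p = dir_deriv (L d) f (L p)"
  using assms by (simp add: dir_deriv_def linear_add linear_cmul)

section \<open>Non-radiating distributions\<close>

lemma light_speed_pos: "\<epsilon>\<^sub>0 > 0 \<Longrightarrow> \<mu>\<^sub>0 > 0 \<Longrightarrow> light_speed \<epsilon>\<^sub>0 \<mu>\<^sub>0 > 0"
  by (simp add: light_speed_def)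

lemma non_radiating_imp_curl_free_in_frame:
  assumes "\<mu>\<^sub>0 \<noteq> 0" and "non_radiating \<epsilon>\<^sub>0 \<mu>\<^sub>0 \<rho> J" and "norm v < light_speed \<epsilon>\<^sub>0 \<mu>\<^sub>0"
  shows "curl (current_in_frame (light_speed \<epsilon>\<^sub>0 \<mu>\<^sub>0) v \<rho> J) p = 0"
  using assms maxwell_no_magnetic_field_imp_curl_free unfolding non_radiating_def by metis

lemma current_in_rest_frame:
  assumes "c > 0"
  shows "current_in_frame c 0 \<rho> J = J"
  using assms
  by (simp add: current_in_frame_def inv_lorentz fun_eq_iff lorentz_def par_def perp_def
      gamma_def split_beta)

lemma non_radiating_imp_curl_free:
  assumes "\<epsilon>\<^sub>0 > 0" and "\<mu>\<^sub>0 > 0" and "non_radiating \<epsilon>\<^sub>0 \<mu>\<^sub>0 \<rho> J"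
  shows "curl J p = 0"
  using non_radiating_imp_curl_free_in_frame[of \<mu>\<^sub>0 \<epsilon>\<^sub>0 \<rho> J 0] light_speed_pos assms
  by (simp add: current_in_rest_frame)

text \<open>In a frame that moves with velocity \<open>u\<close> along the axis \<open>k\<close>, the \<open>(k, i)\<close> component of
  the curl of the current is \<open>\<gamma>\<close> times
  \<open>\<partial>\<^sub>k J\<^sub>i - \<partial>\<^sub>i J\<^sub>k + u (\<partial>\<^sub>t J\<^sub>i / c\<^sup>2 + \<partial>\<^sub>i \<rho>)\<close> for \<open>i \<noteq> k\<close>. The first two terms cancel since
  \<open>J\<close> is curl free in the rest frame.\<close>

lemma non_radiating_imp_partial_t_current:
  fixes \<rho> :: "spacetime \<Rightarrow> real"
  assumes "\<epsilon>\<^sub>0 > 0" and "\<mu>\<^sub>0 > 0" and "smooth \<rho>" and "smooth J"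
    and "non_radiating \<epsilon>\<^sub>0 \<mu>\<^sub>0 \<rho> J"
  shows "\<mu>\<^sub>0 * \<epsilon>\<^sub>0 * partial_t (\<lambda>q. J q $ i) p = - partial_x i \<rho> p"
proof -
  define c where "c = light_speed \<epsilon>\<^sub>0 \<mu>\<^sub>0"
  have "c > 0" and c2: "1 / c\<^sup>2 = \<mu>\<^sub>0 * \<epsilon>\<^sub>0"
    using assms light_speed_pos by (auto simp: c_def light_speed_def power_divide)
  obtain k :: 3 where "i \<noteq> k"
    by (metis exhaust_3 one_neq_zero zero_neq_one num1_eq1)
  \<comment> \<open>Any nonzero speed below \<open>c\<close> would do.\<close>
  define u where "u = c / 2"
  define v :: "real^3" where "v = u *\<^sub>R axis k 1"
  define g where "g = gamma c v"
  define L where "L = lorentz c (- v)"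
  have "u \<noteq> 0"
    using \<open>c > 0\<close> by (simp add: u_def)
  have "norm v < c"
    using \<open>c > 0\<close> by (simp add: u_def v_def)
  have "g \<noteq> 0"
    using \<open>norm v < c\<close> \<open>c > 0\<close> by (simp add: g_def gamma_def)
  \<comment> \<open>\<open>L\<close> maps primed to unprimed coordinates, so it sends the primed axes to the directions
    in which the unprimed sources have to be differentiated.\<close>
  have mv: "- v = (- u) *\<^sub>R axis k 1" and gm: "gamma c (- v) = g"
    by (simp_all add: v_def g_def gamma_def)
  have Lk: "L (axis k 1, 0) = g *\<^sub>R ((axis k 1, 0) + (u / c\<^sup>2) *\<^sub>R (0, 1))"
    using lorentz_axis_parallel[of "- u" c k] \<open>u \<noteq> 0\<close> gm unfolding L_def mv by simp
  have Li: "L (axis i 1, 0) = (axis i 1, 0)"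
    using lorentz_axis_perpendicular[of "- u" i k c] \<open>u \<noteq> 0\<close> \<open>i \<noteq> k\<close> unfolding L_def mv by simp
  define J' where "J' = current_in_frame c v \<rho> J"
  have J': "J' q = g *\<^sub>R (par v (J (L q)) - \<rho> (L q) *\<^sub>R v) + perp v (J (L q))" for q
    using \<open>norm v < c\<close> by (simp add: J'_def current_in_frame_def inv_lorentz L_def g_def)
  have J'k: "(\<lambda>q. J' q $ k) = (\<lambda>q. g * (J (L q) $ k + - u * \<rho> (L q)))"
    using \<open>u \<noteq> 0\<close> by (simp add: J' v_def par_axis perp_def mult.commute)
  have J'i: "(\<lambda>q. J' q $ i) = (\<lambda>q. J (L q) $ i)"
    using \<open>u \<noteq> 0\<close> \<open>i \<noteq> k\<close> by (simp add: J' v_def par_axis perp_def) (simp add: axis_def)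
  have lin: "linear L"
    unfolding L_def by (rule linear_lorentz)
  have Jd: "(\<lambda>q. J q $ j) differentiable (at q)" for j q
    by (intro smooth_imp_differentiable smooth_component assms)
  have \<rho>d: "\<rho> differentiable (at q)" for q
    by (intro smooth_imp_differentiable assms)
  have \<rho>d': "(\<lambda>q. - u * \<rho> q) differentiable (at q)" for q
    using \<rho>d by (intro differentiable_mult) auto
  have p: "L (lorentz c v p) = p"
    unfolding L_def using lorentz_uminus[OF \<open>norm v < c\<close>] .
  have "partial_x k (\<lambda>q. J' q $ i) (lorentz c v p)
      = g * (partial_x k (\<lambda>q. J q $ i) p + u / c\<^sup>2 * partial_t (\<lambda>q. J q $ i) p)"
    unfolding J'i dir_deriv_comp_linear[OF lin, where f = "\<lambda>q. J q $ i"] p Lk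
    by (simp only: dir_deriv_scaleR_direction[OF Jd] dir_deriv_add_direction[OF Jd]
        real_scaleR_def)
  moreover have "partial_x i (\<lambda>q. J' q $ k) (lorentz c v p)
      = g * (partial_x i (\<lambda>q. J q $ k) p + - u * partial_x i \<rho> p)"
    unfolding J'k dir_deriv_comp_linear[OF lin, where f = "\<lambda>q. g * (J q $ k + - u * \<rho> q)"] p Li
    using Jd \<rho>d \<rho>d' by (simp only: dir_deriv_cmult dir_deriv_add differentiable_add)
  moreover have "partial_x k (\<lambda>q. J' q $ i) (lorentz c v p)
      = partial_x i (\<lambda>q. J' q $ k) (lorentz c v p)"
    using non_radiating_imp_curl_free_in_frame[OF _ assms(5)] \<open>norm v < c\<close> assms(2)
    unfolding J'_def c_def curl_eq_0_iff by simp
  moreover have "partial_x k (\<lambda>q. J q $ i) p = partial_x i (\<lambda>q. J q $ k) p"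
    using non_radiating_imp_curl_free[OF assms(1,2,5)] unfolding curl_eq_0_iff by blast
  ultimately have "u * (1 / c\<^sup>2 * partial_t (\<lambda>q. J q $ i) p) = u * (- partial_x i \<rho> p)"
    using \<open>g \<noteq> 0\<close> by simp
  then show ?thesis
    using \<open>u \<noteq> 0\<close> unfolding c2 by (simp only: mult_cancel_left) simp
qed

section \<open>The wave equations\<close>

text \<open>The derivative is pushed inside the sum, since the wave operators will appear as sums of
  second derivatives.\<close>

lemma dir_deriv_continuity_equation:
  assumes "smooth \<rho>" and "smooth J" and "continuity_equation \<rho> J"
  shows "dir_deriv d (partial_t \<rho>) p + (\<Sum>j\<in>UNIV. dir_deriv d (partial_x j (\<lambda>q. J q $ j)) p) = 0"
proof -
  have J: "partial_x j (\<lambda>q. J q $ j) differentiable (at q)" for j q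
    by (intro smooth_imp_differentiable smooth_dir_deriv smooth_component assms)
  have \<rho>: "partial_t \<rho> differentiable (at q)" for q
    by (intro smooth_imp_differentiable smooth_dir_deriv assms)
  have "dir_deriv d (\<lambda>q. partial_t \<rho> q + (\<Sum>j\<in>UNIV. partial_x j (\<lambda>q. J q $ j) q)) p = 0"
    using assms(3) by (simp add: continuity_equation_def divergence_def dir_deriv_const del: split_paired_All)
  then show ?thesis
    using J \<rho> by (simp add: dir_deriv_add dir_deriv_sum)
qed

theorem lemma2p7:
  fixes \<epsilon>\<^sub>0 \<mu>\<^sub>0 :: real
    and \<rho> :: "spacetime \<Rightarrow> real"
    and J :: "spacetime \<Rightarrow> real^3"
  assumes "\<epsilon>\<^sub>0 > 0" and "\<mu>\<^sub>0 > 0"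
    and "smooth \<rho>" and "smooth J"
    and "continuity_equation \<rho> J"
    and "non_radiating \<epsilon>\<^sub>0 \<mu>\<^sub>0 \<rho> J"
  shows "(\<forall>p. dalembertian \<epsilon>\<^sub>0 \<mu>\<^sub>0 \<rho> p = 0) \<and> (\<forall>p. dalembertian_vec \<epsilon>\<^sub>0 \<mu>\<^sub>0 J p = 0)"
proof (intro conjI allI)
  fix p
  define k where "k = \<mu>\<^sub>0 * \<epsilon>\<^sub>0"
  have smooth: "smooth (\<lambda>q. J q $ i)" for i
    using assms(4) by (rule smooth_component)
  have grad: "partial_x i \<rho> = (\<lambda>q. - k * partial_t (\<lambda>q. J q $ i) q)" for i
    using non_radiating_imp_partial_t_current[OF assms(1-4,6)] by (simp add: k_def)
  have grad_t: "k * partial_t (partial_t (\<lambda>q. J q $ i)) p = - partial_t (partial_x i \<rho>) p" for i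
    unfolding grad
    by (simp only: dir_deriv_cmult smooth_imp_differentiable smooth_dir_deriv smooth)
  have curl: "partial_x i (\<lambda>q. J q $ j) = partial_x j (\<lambda>q. J q $ i)" for i j
    using non_radiating_imp_curl_free[OF assms(1,2,6)] unfolding curl_eq_0_iff by blast
  have "partial_x i (partial_x i \<rho>) p = - k * partial_t (partial_x i (\<lambda>q. J q $ i)) p" for i
    unfolding grad
    by (simp only: dir_deriv_cmult smooth_imp_differentiable smooth_dir_deriv smooth
        dir_deriv_commute[OF smooth, of "(axis i 1, 0)"])
  then have "laplacian \<rho> p = - k * (\<Sum>i\<in>UNIV. partial_t (partial_x i (\<lambda>q. J q $ i)) p)"
    by (simp add: laplacian_def sum_distrib_left)
  also have "\<dots> = k * partial_t (partial_t \<rho>) p"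
    using dir_deriv_continuity_equation[OF assms(3-5), of "(0, 1)" p]
    by (simp add: add_eq_0_iff)
  finally show "dalembertian \<epsilon>\<^sub>0 \<mu>\<^sub>0 \<rho> p = 0"
    by (simp add: dalembertian_def k_def)
  have "dalembertian \<epsilon>\<^sub>0 \<mu>\<^sub>0 (\<lambda>q. J q $ i) p = 0" for i
  proof -
    have "laplacian (\<lambda>q. J q $ i) p = (\<Sum>j\<in>UNIV. partial_x j (partial_x i (\<lambda>q. J q $ j)) p)"
      unfolding laplacian_def by (simp only: curl[of i])
    also have "\<dots> = (\<Sum>j\<in>UNIV. partial_x i (partial_x j (\<lambda>q. J q $ j)) p)"
      using dir_deriv_commute[OF smooth] by (intro sum.cong) auto
    also have "\<dots> = - partial_x i (partial_t \<rho>) p"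
      using dir_deriv_continuity_equation[OF assms(3-5), of "(axis i 1, 0)" p] by simp
    also have "\<dots> = k * partial_t (partial_t (\<lambda>q. J q $ i)) p"
      using grad_t dir_deriv_commute[OF assms(3)] by simp
    finally show ?thesis
      by (simp add: dalembertian_def k_def)
  qed
  then show "dalembertian_vec \<epsilon>\<^sub>0 \<mu>\<^sub>0 J p = 0"
    by (simp add: dalembertian_vec_def vec_eq_iff)
qed

end
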